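(* Let $v$ be a harmonic function satisfying a Neumann condition on an arc $\partial\mathbb{D}$ of the unit circle, that is, $\Delta v=0$ near $\partial\mathbb{D}$ and $\frac{\partial v}{\partial n}=\varphi$ on $\partial\mathbb{D}$, where $\varphi$ is holomorphically continuable into $\mathbb{C}^2$ near $\partial\mathbb{D}$. Consider this problem in a neighborhood $\Omega$ of a point of $\partial\mathbb{D}$ that is mapped to itself by the reflection $R$ in the unit circle, and let $z=re^{i\theta}\in\Omega_1\subset\Omega$. Then the following reflection formula holds: $$v\Bigl(\frac{e^{i\theta}}{r},\frac{1}{re^{i\theta}}\Bigr)=v\bigl(re^{i\theta},re^{-i\theta}\bigr)-\int_{1/r}^{r}\frac{\varphi\bigl(\rho e^{i\theta},\frac{1}{\rho e^{i\theta}}\bigr)}{\rho}\,d\rho .$$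
   Context: The unit circle is centered at the origin and $n$ is its outward normal. Functions are complexified by $z=x+iy$, $\zeta=x-iy$, with $\zeta=\bar z$ on $\mathbb{R}^2$: $v(z,\zeta)$ and $\varphi(z,\zeta)$ denote the functions in these variables, so $v(z,\bar z)$ is the value of $v$ at the point $z$ of the plane. The reflection is the anti-conformal mapping $R:\Omega\to\Omega$, $R(re^{i\theta})=e^{i\theta}/r$, which is the identity on the circle and permutes the two components $\Omega_1,\Omega_2$ of $\Omega\setminus\partial\mathbb{D}$. The complexified unit circle is $\{z\zeta=1\}$, so the integrand contains the values of $\varphi$ at the points $(\rho e^{i\theta},\frac{1}{\rho e^{i\theta}})$ of this complexification. *)

theory Defs
  imports "HOL-Analysis.Analysis"
begin

definition dir_deriv :: "complex \<Rightarrow> (complex \<Rightarrow> complex) \<Rightarrow> complex \<Rightarrow> complex" where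
  "dir_deriv e f z = frechet_derivative f (at z) e"

text \<open>The plane is \<^typ>\<open>complex\<close>; \<open>dir_deriv 1\<close> and \<open>dir_deriv \<i>\<close> are the real partial
  derivatives with respect to \<open>x\<close> and \<open>y\<close>. Values are complex, so real-valued functions are
  included through \<^const>\<open>of_real\<close>.\<close>

definition C2_on :: "(complex \<Rightarrow> complex) \<Rightarrow> complex set \<Rightarrow> bool" where
  "C2_on f S \<longleftrightarrow> f differentiable_on S \<and>
     (\<forall>e\<in>{1, \<i>}. dir_deriv e f differentiable_on S) \<and>
     (\<forall>e\<in>{1, \<i>}. \<forall>e'\<in>{1, \<i>}. continuous_on S (dir_deriv e' (dir_deriv e f)))"

definition laplacian :: "(complex \<Rightarrow> complex) \<Rightarrow> complex \<Rightarrow> complex" where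
  "laplacian f z = dir_deriv 1 (dir_deriv 1 f) z + dir_deriv \<i> (dir_deriv \<i> f) z"

definition harmonic_on :: "(complex \<Rightarrow> complex) \<Rightarrow> complex set \<Rightarrow> bool" where
  "harmonic_on f S \<longleftrightarrow> open S \<and> C2_on f S \<and> (\<forall>z\<in>S. laplacian f z = 0)"

text \<open>At a point \<open>z\<close> of the unit circle the outward unit normal is the vector \<open>z\<close> itself.\<close>

definition normal_deriv :: "(complex \<Rightarrow> complex) \<Rightarrow> complex \<Rightarrow> complex" where
  "normal_deriv f z = dir_deriv z f z"

text \<open>Holomorphy in two complex variables: existence of a complex-linear total derivative.\<close>

definition holomorphic2_on :: "(complex \<times> complex \<Rightarrow> complex) \<Rightarrow> (complex \<times> complex) set \<Rightarrow> bool" where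
  "holomorphic2_on f U \<longleftrightarrow> open U \<and>
     (\<forall>p\<in>U. \<exists>a b. (f has_derivative (\<lambda>(h, k). a * h + b * k)) (at p))"

text \<open>Arcs may contain none, one or both of their endpoints, and may be the whole circle.\<close>

definition unit_circle_arc :: "complex set \<Rightarrow> bool" where
  "unit_circle_arc \<Gamma> \<longleftrightarrow> \<Gamma> \<subseteq> sphere 0 1 \<and> connected \<Gamma> \<and> (\<exists>x\<in>\<Gamma>. \<exists>y\<in>\<Gamma>. x \<noteq> y)"

definition circle_reflection :: "complex \<Rightarrow> complex" where
  "circle_reflection z = 1 / cnj z"

lemma circle_reflection_polar:
  "circle_reflection (of_real r * cis \<theta>) = cis \<theta> / of_real r"
  by (simp add: circle_reflection_def cis_cnj flip: cis_inverse) 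
     (simp add: divide_inverse mult.commute)

text \<open>The origin is excluded explicitly because it has no reflection, whereas in HOL
  \<open>circle_reflection 0 = 0\<close>. Since the reflection fixes the circle pointwise, the exchange of
  the two components forces \<open>\<Omega> \<inter> sphere 0 1 \<subseteq> \<Gamma>\<close>.\<close>

definition reflection_nbhd ::
  "complex set \<Rightarrow> complex \<Rightarrow> complex set \<Rightarrow> complex set \<Rightarrow> complex set \<Rightarrow> bool" where
  "reflection_nbhd \<Gamma> p \<Omega> \<Omega>\<^sub>1 \<Omega>\<^sub>2 \<longleftrightarrow>
     p \<in> \<Gamma> \<and> open \<Omega> \<and> p \<in> \<Omega> \<and> 0 \<notin> \<Omega> \<and> circle_reflection ` \<Omega> = \<Omega> \<and>
     components (\<Omega> - \<Gamma>) = {\<Omega>\<^sub>1, \<Omega>\<^sub>2} \<and> \<Omega>\<^sub>1 \<noteq> \<Omega>\<^sub>2 \<and>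
     circle_reflection ` \<Omega>\<^sub>1 = \<Omega>\<^sub>2 \<and> circle_reflection ` \<Omega>\<^sub>2 = \<Omega>\<^sub>1"

text \<open>The Neumann problem with data \<open>\<phi>\<close> can be considered in \<open>\<Omega>\<close>: the solution is defined
  there, and so is \<open>\<phi>\<close> on the part \<open>{(w, 1/w) | w \<in> \<Omega>}\<close> of the complexified circle.\<close>

definition problem_domain ::
  "complex set \<Rightarrow> (complex \<times> complex) set \<Rightarrow> complex set \<Rightarrow> bool" where
  "problem_domain N U \<Omega> \<longleftrightarrow> \<Omega> \<subseteq> N \<and> (\<forall>w\<in>\<Omega>. (w, 1 / w) \<in> U)"

end

(* Write F = 2 dv/dz and K = 2 dv/d(zeta). Harmonicity makes F holomorphic and K antiholomorphic,
   and z F + cnj z K is twice the radial derivative r v_r. With R the reflection, K o R is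
   holomorphic, so the Neumann condition says that the holomorphic function
   z F(z) + K(R z) / z - 2 phi(z, 1/z) vanishes on the circle, hence along the whole radial segment.
   Adding its values at z and R z turns the Wirtinger derivatives back into radial ones:
   r v_r(r) + v_r(1/r) / r = phi(r) + phi(1/r), with phi(r) short for phi(r e^(i t), 1/(r e^(i t))).
   Dividing by r and integrating from 1 gives the formula. *)

theory Submission
  imports Defs "HOL-Complex_Analysis.Complex_Analysis"
begin

subsection \<open>Wirtinger derivatives of harmonic functions\<close>

text \<open>The second difference on the left is symmetric in \<open>e\<close> and \<open>e'\<close>, whence Schwarz's theorem below.\<close>

lemma second_difference_mvt:
  fixes g :: "'a::real_normed_vector \<Rightarrow> real"
  assumes h: "0 < h"
    and g: "\<And>s t. s \<in> {0..h} \<Longrightarrow> t \<in> {0..h} \<Longrightarrow>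
          (g has_derivative G (z + s *\<^sub>R e + t *\<^sub>R e')) (at (z + s *\<^sub>R e + t *\<^sub>R e'))"
    and G: "\<And>s t. s \<in> {0..h} \<Longrightarrow> t \<in> {0..h} \<Longrightarrow>
          ((\<lambda>w. G w e) has_derivative G2 (z + s *\<^sub>R e + t *\<^sub>R e')) (at (z + s *\<^sub>R e + t *\<^sub>R e'))"
  shows "\<exists>s\<in>{0<..<h}. \<exists>t\<in>{0<..<h}.
           g (z + h *\<^sub>R e + h *\<^sub>R e') - g (z + h *\<^sub>R e) - g (z + h *\<^sub>R e') + g z =
           h * h * G2 (z + s *\<^sub>R e + t *\<^sub>R e') e'"
proof -
  have along: "((\<lambda>s. f (z + s *\<^sub>R e + t *\<^sub>R e')) has_real_derivative F e) (at s)"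
    if "(f has_derivative F) (at (z + s *\<^sub>R e + t *\<^sub>R e'))"
    for f :: "'a \<Rightarrow> real" and F s t
  proof -
    have "((\<lambda>s. f (z + s *\<^sub>R e + t *\<^sub>R e')) has_derivative (\<lambda>x. F (x *\<^sub>R e))) (at s)"
      by (rule has_derivative_compose[where f = "\<lambda>s. z + s *\<^sub>R e + t *\<^sub>R e'", OF _ that])
         (auto intro!: derivative_eq_intros)
    moreover have "F (x *\<^sub>R e) = F e * x" for x
      using linear_cmul[OF has_derivative_linear[OF that]] by simp
    ultimately show ?thesis by (simp add: has_field_derivative_def)
  qed
  have along': "((\<lambda>t. f (z + s *\<^sub>R e + t *\<^sub>R e')) has_real_derivative F e') (at t)"
    if "(f has_derivative F) (at (z + s *\<^sub>R e + t *\<^sub>R e'))"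
    for f :: "'a \<Rightarrow> real" and F s t
  proof -
    have "((\<lambda>t. f (z + s *\<^sub>R e + t *\<^sub>R e')) has_derivative (\<lambda>x. F (x *\<^sub>R e'))) (at t)"
      by (rule has_derivative_compose[where f = "\<lambda>t. z + s *\<^sub>R e + t *\<^sub>R e'", OF _ that])
         (auto intro!: derivative_eq_intros)
    moreover have "F (x *\<^sub>R e') = F e' * x" for x
      using linear_cmul[OF has_derivative_linear[OF that]] by simp
    ultimately show ?thesis by (simp add: has_field_derivative_def)
  qed
  \<comment> \<open>The mean value theorem is applied twice: in \<open>s\<close> to the difference
    \<open>d\<close> across the square, then in \<open>t\<close> to \<open>d'\<close>. The term
    \<open>0 *\<^sub>R e'\<close> puts the lower edge into the form that \<open>along\<close>
    covers.\<close>
  define d where "d s = g (z + s *\<^sub>R e + h *\<^sub>R e') - g (z + s *\<^sub>R e + 0 *\<^sub>R e')" for s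
  define d' where "d' s = G (z + s *\<^sub>R e + h *\<^sub>R e') e - G (z + s *\<^sub>R e + 0 *\<^sub>R e') e" for s
  have "(d has_real_derivative d' s) (at s)" if "0 \<le> s" "s \<le> h" for s
    unfolding d_def d'_def using that h by (intro DERIV_diff along g) auto
  from MVT2[OF h this] obtain s where s: "0 < s" "s < h" "d h - d 0 = (h - 0) * d' s"
    by blast
  have "((\<lambda>t. G (z + s *\<^sub>R e + t *\<^sub>R e') e) has_real_derivative
          G2 (z + s *\<^sub>R e + t *\<^sub>R e') e') (at t)" if "0 \<le> t" "t \<le> h" for t
    using that s by (intro along' G) auto
  from MVT2[OF h this]
  obtain t where t: "0 < t" "t < h" "d' s = (h - 0) * G2 (z + s *\<^sub>R e + t *\<^sub>R e') e'"
    unfolding d'_def by blast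
  from s t have "d h - d 0 = h * h * G2 (z + s *\<^sub>R e + t *\<^sub>R e') e'" by simp
  then show ?thesis using s t unfolding d_def
    by (intro bexI[of _ s] bexI[of _ t]) (auto simp: algebra_simps)
qed

lemma C2_on_has_derivative:
  assumes "C2_on f S" "open S" "z \<in> S"
  shows "(f has_derivative frechet_derivative f (at z)) (at z)"
    and "e \<in> {1, \<i>} \<Longrightarrow>
      (dir_deriv e f has_derivative frechet_derivative (dir_deriv e f) (at z)) (at z)"
  using assms unfolding C2_on_def
  by (metis differentiable_on_eq_differentiable_at frechet_derivative_works)+

text \<open>Schwarz's theorem: both mixed derivatives, taken at points that tend to
  \<open>p\<close>, equal the same second difference divided by \<open>h * h\<close>, so their
  continuity makes them agree at \<open>p\<close>.\<close>

lemma dir_deriv_commute: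
  assumes f: "C2_on f S" and S: "open S" and p: "p \<in> S"
  shows "dir_deriv \<i> (dir_deriv 1 f) p = dir_deriv 1 (dir_deriv \<i> f) p"
proof -
  define A where "A = dir_deriv \<i> (dir_deriv 1 f)"
  define B where "B = dir_deriv 1 (dir_deriv \<i> f)"
  have cont: "continuous_on S A" "continuous_on S B"
    using f by (auto simp: C2_on_def A_def B_def)
  \<comment> \<open>The mean value theorem needs real values, so real and imaginary parts are
    compared separately.\<close>
  have L: "L (A p) = L (B p)" if L: "L \<in> {Re, Im}" for L :: "complex \<Rightarrow> real"
  proof -
    have bl: "bounded_linear L" using L bounded_linear_Re bounded_linear_Im by auto
    have Lle: "\<bar>L x - L y\<bar> \<le> dist x y" for x y
      using L abs_Re_le_cmod[of "x - y"] abs_Im_le_cmod[of "x - y"] by (auto simp: dist_norm)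
    have "\<bar>L (A p) - L (B p)\<bar> \<le> 0 + \<epsilon>" if "\<epsilon> > 0" for \<epsilon>
    proof -
      have "eventually (\<lambda>w. w \<in> S \<and> dist (A w) (A p) < \<epsilon>/2 \<and> dist (B w) (B p) < \<epsilon>/2) (nhds p)"
        using cont S p \<open>\<epsilon> > 0\<close>
        by (intro eventually_conj eventually_nhds_in_open tendstoD)
           (auto simp: continuous_on_eq_continuous_at isCont_def tendsto_at_iff_tendsto_nhds)
      then obtain \<delta> where \<delta>: "\<delta> > 0"
        "\<And>w. dist w p < \<delta> \<Longrightarrow> w \<in> S \<and> dist (A w) (A p) < \<epsilon>/2 \<and> dist (B w) (B p) < \<epsilon>/2"
        unfolding eventually_nhds_metric by blast
      \<comment> \<open>The square with corner \<open>p\<close> and side \<open>h\<close> stays in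
        the \<open>\<delta>\<close>-ball, since \<open>s + t\<close> is at most
        \<open>2 * h\<close>.\<close>
      define h where "h = \<delta> / 3"
      have h: "h > 0" using \<delta> by (simp add: h_def)
      have near: "dist (p + s *\<^sub>R e + t *\<^sub>R e') p < \<delta>"
        if "s \<in> {0..h}" "t \<in> {0..h}" "{e, e'} \<subseteq> {1, \<i>}" for s t e e'
      proof -
        have "dist (p + s *\<^sub>R e + t *\<^sub>R e') p \<le> norm (s *\<^sub>R e) + norm (t *\<^sub>R e')"
          using norm_triangle_ineq[of "s *\<^sub>R e" "t *\<^sub>R e'"] by (simp add: dist_norm add_ac)
        also have "\<dots> = s + t" using that by auto
        also have "\<dots> < \<delta>" using that \<delta> by (auto simp: h_def)
        finally show ?thesis .
      qed
      have mvt: "\<exists>s\<in>{0<..<h}. \<exists>t\<in>{0<..<h}.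
           L (f (p + h *\<^sub>R e + h *\<^sub>R e')) - L (f (p + h *\<^sub>R e)) - L (f (p + h *\<^sub>R e')) + L (f p) =
           h * h * L (dir_deriv e' (dir_deriv e f) (p + s *\<^sub>R e + t *\<^sub>R e'))"
        if ee: "{e, e'} \<subseteq> {1, \<i>}" for e e'
        unfolding dir_deriv_def[of e']
      proof (rule second_difference_mvt[OF h, where g = "\<lambda>w. L (f w)"
            and G = "\<lambda>w h. L (frechet_derivative f (at w) h)"
            and ?G2.0 = "\<lambda>w h. L (frechet_derivative (dir_deriv e f) (at w) h)"])
        fix s t assume st: "s \<in> {0..h}" "t \<in> {0..h}"
        let ?w = "p + s *\<^sub>R e + t *\<^sub>R e'"
        have w: "?w \<in> S" using \<delta>(2)[OF near[OF st ee]] by blast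
        show "((\<lambda>w. L (f w)) has_derivative (\<lambda>h. L (frechet_derivative f (at ?w) h))) (at ?w)"
          by (intro bounded_linear.has_derivative[OF bl] C2_on_has_derivative(1)[OF f S w])
        have "((\<lambda>w. L (dir_deriv e f w)) has_derivative
             (\<lambda>h. L (frechet_derivative (dir_deriv e f) (at ?w) h))) (at ?w)"
          using ee by (intro bounded_linear.has_derivative[OF bl] C2_on_has_derivative(2)[OF f S w]) auto
        then show "((\<lambda>w. L (frechet_derivative f (at w) e)) has_derivative
             (\<lambda>h. L (frechet_derivative (dir_deriv e f) (at ?w) h))) (at ?w)"
          by (simp add: dir_deriv_def)
      qed
      obtain s t where st: "s \<in> {0<..<h}" "t \<in> {0<..<h}"
        "L (f (p + h *\<^sub>R 1 + h *\<^sub>R \<i>)) - L (f (p + h *\<^sub>R 1)) - L (f (p + h *\<^sub>R \<i>)) + L (f p) =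
           h * h * L (A (p + s *\<^sub>R 1 + t *\<^sub>R \<i>))"
        using mvt[of 1 \<i>] unfolding A_def by blast
      obtain s' t' where st': "s' \<in> {0<..<h}" "t' \<in> {0<..<h}"
        "L (f (p + h *\<^sub>R \<i> + h *\<^sub>R 1)) - L (f (p + h *\<^sub>R \<i>)) - L (f (p + h *\<^sub>R 1)) + L (f p) =
           h * h * L (B (p + s' *\<^sub>R \<i> + t' *\<^sub>R 1))"
        using mvt[of \<i> 1] unfolding B_def by blast
      have "h * h * L (A (p + s *\<^sub>R 1 + t *\<^sub>R \<i>)) = h * h * L (B (p + s' *\<^sub>R \<i> + t' *\<^sub>R 1))"
        unfolding st(3)[symmetric] st'(3)[symmetric]
        by (simp add: add.assoc add.commute[of "h *\<^sub>R 1" "h *\<^sub>R \<i>"])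
      then have "L (A (p + s *\<^sub>R 1 + t *\<^sub>R \<i>)) = L (B (p + s' *\<^sub>R \<i> + t' *\<^sub>R 1))"
        using h by simp
      moreover have "dist (A (p + s *\<^sub>R 1 + t *\<^sub>R \<i>)) (A p) < \<epsilon>/2"
        using \<delta>(2)[OF near[of s t 1 \<i>]] st by auto
      moreover have "dist (B (p + s' *\<^sub>R \<i> + t' *\<^sub>R 1)) (B p) < \<epsilon>/2"
        using \<delta>(2)[OF near[of s' t' \<i> 1]] st' by auto
      ultimately show ?thesis
        using Lle[of "A (p + s *\<^sub>R 1 + t *\<^sub>R \<i>)" "A p"] Lle[of "B (p + s' *\<^sub>R \<i> + t' *\<^sub>R 1)" "B p"]
        by linarith
    qed
    then have "\<bar>L (A p) - L (B p)\<bar> \<le> 0" by (rule field_le_epsilon)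
    then show ?thesis by simp
  qed
  show ?thesis using L[of Re] L[of Im] by (simp add: A_def B_def complex_eq_iff)
qed

section \<open>Holomorphy of the Wirtinger derivatives\<close>

text \<open>These are \<open>2 \<partial>f/\<partial>z\<close> and \<open>2 \<partial>f/\<partial>\<zeta>\<close>.\<close>

definition wirtinger_z :: "(complex \<Rightarrow> complex) \<Rightarrow> complex \<Rightarrow> complex" where
  "wirtinger_z f z = dir_deriv 1 f z - \<i> * dir_deriv \<i> f z"

definition wirtinger_zeta :: "(complex \<Rightarrow> complex) \<Rightarrow> complex \<Rightarrow> complex" where
  "wirtinger_zeta f z = dir_deriv 1 f z + \<i> * dir_deriv \<i> f z"

lemma linear_complex_expand:
  fixes L :: "complex \<Rightarrow> complex"
  assumes "linear L"
  shows "L h = of_real (Re h) * L 1 + of_real (Im h) * L \<i>"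
proof -
  have "h = Re h *\<^sub>R 1 + Im h *\<^sub>R \<i>"
    by (simp add: complex_eq_iff)
  then have "L h = L (Re h *\<^sub>R 1 + Im h *\<^sub>R \<i>)"
    by (rule arg_cong)
  also have "\<dots> = Re h *\<^sub>R L 1 + Im h *\<^sub>R L \<i>"
    by (simp only: linear_add[OF assms] linear_cmul[OF assms])
  finally show ?thesis by (simp add: scaleR_conv_of_real)
qed

text \<open>Laplace's equation together with the equality of the mixed derivatives gives the
  Cauchy-Riemann equations for \<open>f_x - i f_y\<close>.\<close>

lemma harmonic_on_wirtinger_z:
  assumes f: "harmonic_on f S" and z: "z \<in> S"
  shows "wirtinger_z f field_differentiable at z"
proof -
  have S: "open S" "C2_on f S" and lap: "laplacian f z = 0"
    using f z by (auto simp: harmonic_on_def)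
  let ?P = "frechet_derivative (dir_deriv 1 f) (at z)"
  let ?Q = "frechet_derivative (dir_deriv \<i> f) (at z)"
  note P = C2_on_has_derivative(2)[OF S(2,1) z, of 1, simplified]
  note Q = C2_on_has_derivative(2)[OF S(2,1) z, of \<i>, simplified]
  have "?P \<i> = ?Q 1" "?Q \<i> = - ?P 1"
    using dir_deriv_commute[OF S(2,1) z] lap
    by (auto simp: dir_deriv_def[abs_def] laplacian_def add_eq_0_iff)
  then have eq: "?P h - \<i> * ?Q h = (?P 1 - \<i> * ?Q 1) * h" for h
    unfolding linear_complex_expand[OF has_derivative_linear[OF P], of h]
      linear_complex_expand[OF has_derivative_linear[OF Q], of h]
    by (simp add: complex_eq_iff algebra_simps)
  have "(wirtinger_z f has_derivative (\<lambda>h. ?P h - \<i> * ?Q h)) (at z)"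
    unfolding wirtinger_z_def[abs_def]
    by (intro has_derivative_diff has_derivative_mult_right P Q)
  then have "(wirtinger_z f has_derivative (\<lambda>h. (?P 1 - \<i> * ?Q 1) * h)) (at z)"
    by (rule has_derivative_eq_rhs) (rule ext, rule eq)
  then show ?thesis
    by (auto simp: field_differentiable_def has_field_derivative_def)
qed

text \<open>The same two relations make the derivative of \<open>f_x + i f_y\<close>
  conjugate-linear; composing with the reflection will turn it into a holomorphic function.\<close>

lemma harmonic_on_wirtinger_zeta:
  assumes f: "harmonic_on f S" and z: "z \<in> S"
  shows "\<exists>c. (wirtinger_zeta f has_derivative (\<lambda>h. c * cnj h)) (at z)"
proof -
  have S: "open S" "C2_on f S" and lap: "laplacian f z = 0"
    using f z by (auto simp: harmonic_on_def)
  let ?P = "frechet_derivative (dir_deriv 1 f) (at z)"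
  let ?Q = "frechet_derivative (dir_deriv \<i> f) (at z)"
  note P = C2_on_has_derivative(2)[OF S(2,1) z, of 1, simplified]
  note Q = C2_on_has_derivative(2)[OF S(2,1) z, of \<i>, simplified]
  have "?P \<i> = ?Q 1" "?Q \<i> = - ?P 1"
    using dir_deriv_commute[OF S(2,1) z] lap
    by (auto simp: dir_deriv_def[abs_def] laplacian_def add_eq_0_iff)
  then have eq: "?P h + \<i> * ?Q h = (?P 1 + \<i> * ?Q 1) * cnj h" for h
    unfolding linear_complex_expand[OF has_derivative_linear[OF P], of h]
      linear_complex_expand[OF has_derivative_linear[OF Q], of h]
    by (simp add: complex_eq_iff algebra_simps)
  have "(wirtinger_zeta f has_derivative (\<lambda>h. ?P h + \<i> * ?Q h)) (at z)"
    unfolding wirtinger_zeta_def[abs_def]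
    by (intro has_derivative_add has_derivative_mult_right P Q)
  then have "(wirtinger_zeta f has_derivative (\<lambda>h. (?P 1 + \<i> * ?Q 1) * cnj h)) (at z)"
    by (rule has_derivative_eq_rhs) (rule ext, rule eq)
  then show ?thesis by blast
qed

text \<open>With \<open>e = z\<close> this translates between radial and Wirtinger derivatives, in
  both directions.\<close>

lemma dir_deriv_wirtinger:
  assumes "f differentiable at z"
  shows "2 * dir_deriv e f z = e * wirtinger_z f z + cnj e * wirtinger_zeta f z"
proof -
  have "linear (frechet_derivative f (at z))"
    using assms by (simp add: linear_frechet_derivative)
  from linear_complex_expand[OF this, of e]
  have *: "dir_deriv e f z = of_real (Re e) * dir_deriv 1 f z + of_real (Im e) * dir_deriv \<i> f z"
    by (simp only: dir_deriv_def)
  show ?thesis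
    unfolding * wirtinger_z_def wirtinger_zeta_def by (simp add: complex_eq_iff algebra_simps)
qed

subsection \<open>Reflection in the unit circle\<close>

lemma circle_reflection_involution: "circle_reflection (circle_reflection z) = z"
  by (simp add: circle_reflection_def)

lemma circle_reflection_fixes_sphere:
  assumes "norm z = 1"
  shows "circle_reflection z = z" and "1 / z = cnj z"
proof -
  have "z * cnj z = 1" "z \<noteq> 0"
    using assms complex_norm_square[of z] by auto
  then show "circle_reflection z = z" and "1 / z = cnj z"
    by (auto simp: circle_reflection_def nonzero_divide_eq_eq divide_eq_eq mult.commute)
qed

lemma circle_reflection_exp: "circle_reflection (exp w) = exp (- cnj w)"
  by (simp add: circle_reflection_def exp_minus exp_cnj divide_inverse)

lemma circle_reflection_has_derivative:
  assumes "z \<noteq> 0"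
  shows "(circle_reflection has_derivative (\<lambda>h. - cnj (h / z\<^sup>2))) (at z)"
proof -
  have "((\<lambda>z. inverse (cnj z)) has_derivative (\<lambda>h. - (inverse (cnj z) * cnj h * inverse (cnj z)))) (at z)"
    using assms by (intro Deriv.has_derivative_inverse bounded_linear.has_derivative[OF bounded_linear_cnj]
        has_derivative_ident) auto
  then show ?thesis
    by (simp add: circle_reflection_def[abs_def] divide_inverse power2_eq_square mult_ac)
qed

text \<open>Both the reflection and \<open>wirtinger_zeta f\<close> have conjugate-linear
  derivatives, and the composition of two such maps is complex-linear.\<close>

lemma wirtinger_zeta_circle_reflection:
  assumes f: "harmonic_on f N" and z: "z \<noteq> 0" "circle_reflection z \<in> N"
  shows "(\<lambda>z. wirtinger_zeta f (circle_reflection z)) field_differentiable at z"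
proof -
  obtain c where "(wirtinger_zeta f has_derivative (\<lambda>h. c * cnj h)) (at (circle_reflection z))"
    using harmonic_on_wirtinger_zeta[OF f z(2)] by blast
  from has_derivative_compose[OF circle_reflection_has_derivative[OF z(1)] this]
  have "((\<lambda>z. wirtinger_zeta f (circle_reflection z)) has_derivative (\<lambda>h. - c / z\<^sup>2 * h)) (at z)"
    by (rule has_derivative_eq_rhs) (auto simp: fun_eq_iff)
  then show ?thesis
    unfolding field_differentiable_def has_field_derivative_def by (rule exI)
qed

text \<open>The chain rule along \<open>(z, 1 / z)\<close>, which parametrizes the complexified
  circle, makes the Neumann data a holomorphic function of one variable.\<close>

lemma holomorphic2_on_hyperbola:
  assumes \<phi>: "holomorphic2_on \<phi> U" and z: "z \<noteq> 0" "(z, 1 / z) \<in> U"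
  shows "(\<lambda>z. \<phi> (z, 1 / z)) field_differentiable at z"
proof -
  obtain a b where "(\<phi> has_derivative (\<lambda>(h, k). a * h + b * k)) (at (z, inverse z))"
    using \<phi> z(2) by (auto simp: holomorphic2_on_def divide_inverse)
  moreover have "((\<lambda>z. (z, inverse z)) has_derivative
      (\<lambda>h. (h, - (inverse z * h * inverse z)))) (at z)"
    using z(1) by (intro has_derivative_Pair has_derivative_ident Deriv.has_derivative_inverse) auto
  ultimately have "((\<lambda>z. \<phi> (z, inverse z)) has_derivative
      (\<lambda>h. (a - b * (inverse z * inverse z)) * h)) (at z)"
    using has_derivative_compose[where f = "\<lambda>z. (z, inverse z)"]
    by (rule_tac has_derivative_eq_rhs) (fastforce simp: fun_eq_iff algebra_simps)+
  then show ?thesis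
    by (auto simp: field_differentiable_def has_field_derivative_def divide_inverse)
qed

section \<open>Continuation of the Neumann condition off the circle\<close>

text \<open>Supplies the accumulation point for the identity theorem: a connected set with more than
  one point has no isolated points.\<close>

lemma islimpt_sphere_Int_open:
  fixes q :: complex
  assumes "norm q = 1" "open C" "q \<in> C"
  shows "q islimpt sphere 0 1 \<inter> C"
proof (rule islimpt_Int_eventually)
  have "sphere 0 1 \<noteq> {x}" for x :: complex
  proof
    assume "sphere 0 1 = {x}"
    moreover have "(1::complex) \<in> sphere 0 1" "(-1::complex) \<in> sphere 0 1"
      by (auto simp: dist_norm)
    ultimately have "(1::complex) = -1" by (metis singletonD)
    then show False by simp
  qed
  then show "q islimpt sphere 0 1"
    using assms by (intro connected_imp_perfect connected_sphere) auto
  show "\<forall>\<^sub>F y in at q. y \<in> C"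
    using assms by (simp add: eventually_at_in_open')
qed

text \<open>The circle is the zero set of \<open>1 - z \<zeta>\<close>, so the Neumann condition, once written with
  \<open>\<zeta> = 1 / z\<close>, extends from the circle by the identity theorem.\<close>

lemma neumann_continuation:
  assumes f: "harmonic_on f N" and \<phi>: "holomorphic2_on \<phi> U"
    and C: "open C" "connected C" "0 \<notin> C" "C \<subseteq> N" "circle_reflection ` C \<subseteq> N"
    and U: "\<And>w. w \<in> C \<Longrightarrow> (w, 1 / w) \<in> U"
    and neumann: "\<And>w. w \<in> C \<Longrightarrow> norm w = 1 \<Longrightarrow> normal_deriv f w = \<phi> (w, cnj w)"
    and q: "q \<in> C" "norm q = 1" and z: "z \<in> C"
  shows "z * wirtinger_z f z + 1 / z * wirtinger_zeta f (circle_reflection z) = 2 * \<phi> (z, 1 / z)"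
proof -
  define H where "H z = z * wirtinger_z f z + inverse z * wirtinger_zeta f (circle_reflection z)
     - 2 * \<phi> (z, 1 / z)" for z
  have diff: "f differentiable at w" if "w \<in> N" for w
    using f that by (auto simp: harmonic_on_def C2_on_def differentiable_on_eq_differentiable_at)
  have "H field_differentiable at w" if "w \<in> C" for w
    unfolding H_def[abs_def] using that C U
    by (intro derivative_intros field_differentiable_mult field_differentiable_add field_differentiable_diff
        field_differentiable_inverse field_differentiable_ident field_differentiable_const
        harmonic_on_wirtinger_z[OF f] wirtinger_zeta_circle_reflection[OF f]
        holomorphic2_on_hyperbola[OF \<phi>]) auto
  then have "H holomorphic_on C"
    by (auto simp: holomorphic_on_def intro: field_differentiable_at_within)
  \<comment> \<open>On the circle the reflection fixes \<open>w\<close> and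
    \<open>1 / w = cnj w\<close>, so \<open>H w\<close> is twice the normal derivative minus twice
    the data.\<close>
  moreover have "H w = 0" if "w \<in> sphere 0 1 \<inter> C" for w
    using that C dir_deriv_wirtinger[OF diff, of w w] neumann[of w] circle_reflection_fixes_sphere[of w]
    by (auto simp: H_def normal_deriv_def field_simps)
  ultimately have "H z = 0"
    using analytic_continuation[of H C "sphere 0 1 \<inter> C" q z] C q z
      islimpt_sphere_Int_open[OF q(2) C(1) q(1)] by blast
  then show ?thesis by (simp add: H_def divide_inverse)
qed

text \<open>The continued condition at \<open>z\<close> involves \<open>wirtinger_zeta f\<close> at
  the reflected point, and the one at the reflected point involves it at \<open>z\<close>. Added
  together, the two contain exactly the terms of both radial derivatives.\<close>

lemma neumann_reflection:
  assumes f: "harmonic_on f N" and \<phi>: "holomorphic2_on \<phi> U"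
    and C: "open C" "connected C" "0 \<notin> C" "C \<subseteq> N" "circle_reflection ` C \<subseteq> N"
    and U: "\<And>w. w \<in> C \<Longrightarrow> (w, 1 / w) \<in> U"
    and neumann: "\<And>w. w \<in> C \<Longrightarrow> norm w = 1 \<Longrightarrow> normal_deriv f w = \<phi> (w, cnj w)"
    and q: "q \<in> C" "norm q = 1" and z: "z \<in> C" "circle_reflection z \<in> C"
  shows "dir_deriv z f z + dir_deriv (circle_reflection z) f (circle_reflection z) =
    \<phi> (z, 1 / z) + \<phi> (circle_reflection z, 1 / circle_reflection z)"
proof -
  let ?R = "circle_reflection"
  have diff: "f differentiable at w" if "w \<in> C" for w
    using f that C by (auto simp: harmonic_on_def C2_on_def differentiable_on_eq_differentiable_at)
  have R: "cnj (?R z) = 1 / z" "1 / ?R z = cnj z"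
    by (auto simp: circle_reflection_def)
  have cont: "w * wirtinger_z f w + 1 / w * wirtinger_zeta f (?R w) = 2 * \<phi> (w, 1 / w)"
    if "w \<in> C" for w
    using U neumann that by (intro neumann_continuation[OF f \<phi> C _ _ q]) auto
  \<comment> \<open>Here \<open>a\<close>, \<open>c\<close> stand for the \<open>wirtinger_z\<close>
    terms at \<open>z\<close> and its reflection, and \<open>b\<close>, \<open>d\<close> for the
    \<open>wirtinger_zeta\<close> terms; radial derivatives pair \<open>a\<close> with
    \<open>b\<close>, the continued condition pairs \<open>a\<close> with \<open>d\<close>.\<close>
  have cancel: "x + y = s + t"
    if "2 * x = a + b" "2 * y = c + d" "a + d = 2 * s" "c + b = 2 * t" for a b c d s t x y :: complex
  proof -
    have "2 * (x + y) = (a + d) + (c + b)" using that(1,2) by (simp add: distrib_left)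
    also have "\<dots> = 2 * (s + t)" by (simp only: that(3,4) distrib_left)
    finally show ?thesis by (simp only: mult_cancel_left) simp
  qed
  show ?thesis
    using dir_deriv_wirtinger[OF diff[OF z(1)], of z] dir_deriv_wirtinger[OF diff[OF z(2)], of "?R z"]
      cont[OF z(1)] cont[OF z(2)]
    unfolding circle_reflection_involution R by (rule cancel)
qed

section \<open>Integration along a ray\<close>

text \<open>The symmetry hypothesis says that a function that is odd under inversion of the radius
  has derivative zero; it vanishes at the fixed point 1, hence everywhere on \<open>J\<close>. The
  endpoints are sorted by \<open>min\<close> and \<open>max\<close> because \<open>r\<close> may lie
  on either side of 1.\<close>

lemma integral_inversion_symmetric:
  fixes E D \<psi> :: "real \<Rightarrow> complex"
  assumes r: "0 < r" and J: "J = {min (1 / r) r..max (1 / r) r}"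
    and E: "\<And>\<rho>. \<rho> \<in> J \<Longrightarrow> (E has_vector_derivative D \<rho>) (at \<rho> within J)"
    and \<psi>: "continuous_on J \<psi>"
    and sym: "\<And>\<rho>. \<rho> \<in> J \<Longrightarrow>
      D \<rho> + D (1 / \<rho>) / of_real (\<rho>\<^sup>2) = \<psi> \<rho> + \<psi> (1 / \<rho>) / of_real (\<rho>\<^sup>2)"
  shows "E (1 / r) = E r - (LBINT \<rho>=ereal (1 / r)..ereal r. \<psi> \<rho>)"
proof -
  have J_pos: "\<rho> > 0" if "\<rho> \<in> J" for \<rho>
    using that r by (auto simp: J min_le_iff_disj) (smt (verit) divide_pos_pos)
  have J_inv: "1 / \<rho> \<in> J" if "\<rho> \<in> J" for \<rho>
    using that r J_pos[OF that] by (auto simp: J min_le_iff_disj le_max_iff_disj field_simps)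
  have r1: "r \<in> J" "1 \<in> J"
    using r by (auto simp: J min_le_iff_disj le_max_iff_disj field_simps)
  \<comment> \<open>A primitive of \<open>\<psi>\<close>; its base point is immaterial because only
    differences of its values occur.\<close>
  define \<Phi> where "\<Phi> x = integral {min (1 / r) r..x} \<psi>" for x
  have \<Phi>: "(\<Phi> has_vector_derivative \<psi> \<rho>) (at \<rho> within J)" if "\<rho> \<in> J" for \<rho>
    unfolding \<Phi>_def[abs_def] J
    using integral_has_vector_derivative \<psi> that unfolding J by blast
  have inv: "((\<lambda>\<rho>. F (1 / \<rho>)) has_vector_derivative - (F' (1 / \<rho>) / of_real (\<rho>\<^sup>2))) (at \<rho> within J)"
    if "\<And>\<rho>. \<rho> \<in> J \<Longrightarrow> (F has_vector_derivative F' \<rho>) (at \<rho> within J)" "\<rho> \<in> J"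
    for F F' :: "real \<Rightarrow> complex" and \<rho>
  proof -
    have "((\<lambda>\<rho>. 1 / \<rho>) has_vector_derivative - (1 / \<rho>\<^sup>2)) (at \<rho> within J)"
      using J_pos[OF that(2)]
      by (auto intro!: derivative_eq_intros simp: power2_eq_square
          simp flip: has_real_derivative_iff_has_vector_derivative)
    \<comment> \<open>Inversion maps \<open>J\<close> into itself, so one-sided derivatives at the
      endpoints are carried along by the chain rule.\<close>
    moreover have "(F has_vector_derivative F' (1 / \<rho>)) (at (1 / \<rho>) within (\<lambda>\<rho>. 1 / \<rho>) ` J)"
      using that(1)[OF J_inv[OF that(2)]] J_inv
      by (rule_tac has_vector_derivative_within_subset) auto
    ultimately have "((F \<circ> (\<lambda>\<rho>. 1 / \<rho>)) has_vector_derivative (- (1 / \<rho>\<^sup>2)) *\<^sub>R F' (1 / \<rho>)) (at \<rho> within J)"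
      by (rule vector_diff_chain_within)
    then show ?thesis
      by (simp add: o_def scaleR_conv_of_real divide_inverse mult.commute)
  qed
  define g where "g \<rho> = E \<rho> - E (1 / \<rho>) - \<Phi> \<rho> + \<Phi> (1 / \<rho>)" for \<rho>
  have "(g has_vector_derivative 0) (at \<rho> within J)" if "\<rho> \<in> J" for \<rho>
  proof -
    have "(g has_vector_derivative D \<rho> - (- (D (1 / \<rho>) / of_real (\<rho>\<^sup>2))) - \<psi> \<rho>
        + (- (\<psi> (1 / \<rho>) / of_real (\<rho>\<^sup>2)))) (at \<rho> within J)"
      unfolding g_def[abs_def] using that
      by (intro has_vector_derivative_add has_vector_derivative_diff E \<Phi> inv)
    moreover have "D \<rho> - (- (D (1 / \<rho>) / of_real (\<rho>\<^sup>2))) - \<psi> \<rho>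
        + (- (\<psi> (1 / \<rho>) / of_real (\<rho>\<^sup>2))) = 0"
      using sym[OF that] by (simp add: algebra_simps)
    ultimately show ?thesis by metis
  qed
  moreover have "convex J" by (simp add: J)
  ultimately obtain c where "\<And>\<rho>. \<rho> \<in> J \<Longrightarrow> g \<rho> = c"
    using has_vector_derivative_zero_constant by metis
  then have "g r = g 1" using r1 by simp
  then have "g r = 0" by (simp add: g_def)
  moreover have "(LBINT \<rho>=ereal (1 / r)..ereal r. \<psi> \<rho>) = \<Phi> r - \<Phi> (1 / r)"
    using \<psi> \<Phi> unfolding J by (intro interval_integral_FTC_finite) auto
  ultimately show ?thesis by (simp only: g_def) algebra
qed

lemma closed_segment_circle_reflection:
  assumes "0 < r"
  shows "closed_segment (circle_reflection (of_real r * cis \<theta>)) (of_real r * cis \<theta>) =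
    (\<lambda>\<rho>. of_real \<rho> * cis \<theta>) ` {min (1 / r) r..max (1 / r) r}"
proof -
  let ?l = "\<lambda>\<rho>::real. of_real \<rho> * cis \<theta>"
  have "linear ?l" by (auto intro!: linearI simp: algebra_simps scaleR_conv_of_real)
  then have "closed_segment (?l (1 / r)) (?l r) = ?l ` closed_segment (1 / r) r"
    by (rule closed_segment_linear_image)
  moreover have "circle_reflection (?l r) = ?l (1 / r)"
    by (simp add: circle_reflection_polar)
  ultimately show ?thesis
    by (simp only: closed_segment_eq_real_ivl min_def max_def) auto
qed

text \<open>A circle point of \<open>\<Omega>\<close> outside \<open>\<Gamma>\<close> would lie in
  one component and, being fixed by the reflection, also in the other. Hence the Neumann condition
  is available at every circle point of \<open>\<Omega>\<close>.\<close>

lemma reflection_nbhd_sphere: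
  assumes "reflection_nbhd \<Gamma> p \<Omega> \<Omega>\<^sub>1 \<Omega>\<^sub>2"
  shows "\<Omega> \<inter> sphere 0 1 \<subseteq> \<Gamma>"
proof
  fix x assume x: "x \<in> \<Omega> \<inter> sphere 0 1"
  have c: "components (\<Omega> - \<Gamma>) = {\<Omega>\<^sub>1, \<Omega>\<^sub>2}" "\<Omega>\<^sub>1 \<noteq> \<Omega>\<^sub>2"
    "circle_reflection ` \<Omega>\<^sub>1 = \<Omega>\<^sub>2" "circle_reflection ` \<Omega>\<^sub>2 = \<Omega>\<^sub>1"
    using assms by (auto simp: reflection_nbhd_def)
  have "\<Omega>\<^sub>1 \<inter> \<Omega>\<^sub>2 = {}"
    using c components_nonoverlap[of \<Omega>\<^sub>1 "\<Omega> - \<Gamma>" \<Omega>\<^sub>2] by auto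
  moreover have "\<Omega> - \<Gamma> = \<Omega>\<^sub>1 \<union> \<Omega>\<^sub>2"
    using Union_components[of "\<Omega> - \<Gamma>"] c by auto
  moreover have "circle_reflection x = x"
    using x circle_reflection_fixes_sphere by auto
  ultimately show "x \<in> \<Gamma>"
    using x c by (metis DiffI IntD1 UnE disjoint_iff image_eqI)
qed

text \<open>The segment from the reflected point to the given one crosses the circle at
  \<open>cis \<theta>\<close>; this crossing anchors the continuation, and the resulting radial
  identity is integrated along the segment.\<close>

lemma reflection_formula:
  assumes harm: "harmonic_on f N" and holo: "holomorphic2_on \<phi> U"
    and neumann: "\<forall>z\<in>\<Gamma>. normal_deriv f z = \<phi> (z, cnj z)"
    and \<Omega>: "reflection_nbhd \<Gamma> p \<Omega> \<Omega>\<^sub>1 \<Omega>\<^sub>2" "problem_domain N U \<Omega>"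
    and r: "0 < r"
    and seg: "closed_segment (circle_reflection (of_real r * cis \<theta>)) (of_real r * cis \<theta>) \<subseteq> \<Omega>"
  shows "f (cis \<theta> / of_real r) = f (of_real r * cis \<theta>) -
    (LBINT \<rho>=ereal (1 / r)..ereal r.
      \<phi> (of_real \<rho> * cis \<theta>, 1 / (of_real \<rho> * cis \<theta>)) / of_real \<rho>)"
proof -
  define J where "J = {min (1 / r) r..max (1 / r) r}"
  define w where "w \<rho> = of_real \<rho> * cis \<theta>" for \<rho> :: real
  define \<psi> where "\<psi> \<rho> = \<phi> (w \<rho>, 1 / w \<rho>) / of_real \<rho>" for \<rho>
  define D where "D \<rho> = dir_deriv (cis \<theta>) f (w \<rho>)" for \<rho>
  \<comment> \<open>The identity theorem needs a connected domain, and \<open>\<Omega>\<close> may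
    be disconnected; this component contains the whole segment.\<close>
  define C where "C = connected_component_set \<Omega> (cis \<theta>)"
  have O: "open \<Omega>" "0 \<notin> \<Omega>" "circle_reflection ` \<Omega> = \<Omega>" "\<Omega> \<subseteq> N"
    "\<And>w. w \<in> \<Omega> \<Longrightarrow> (w, 1 / w) \<in> U"
    using \<Omega> by (auto simp: reflection_nbhd_def problem_domain_def)
  have J_pos: "\<rho> > 0" if "\<rho> \<in> J" for \<rho>
    using that r by (auto simp: J_def min_le_iff_disj) (smt (verit) divide_pos_pos)
  have J_inv: "1 / \<rho> \<in> J" if "\<rho> \<in> J" for \<rho>
    using that r J_pos[OF that] by (auto simp: J_def min_le_iff_disj le_max_iff_disj field_simps)
  have "1 \<in> J"
    using r by (auto simp: J_def min_le_iff_disj le_max_iff_disj field_simps)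
  have wJ: "w ` J = closed_segment (circle_reflection (w r)) (w r)"
    unfolding w_def[abs_def] J_def by (rule closed_segment_circle_reflection[OF r, symmetric])
  have q: "w 1 = cis \<theta>" "norm (cis \<theta>) = 1" by (simp_all add: w_def)
  have "cis \<theta> \<in> w ` J" using \<open>1 \<in> J\<close> q(1) by (metis imageI)
  moreover have "connected (w ` J)" "w ` J \<subseteq> \<Omega>"
    using seg unfolding wJ by (simp_all add: w_def)
  ultimately have "w ` J \<subseteq> C"
    unfolding C_def by (intro connected_component_maximal)
  then have wC: "w \<rho> \<in> C" if "\<rho> \<in> J" for \<rho>
    using that by blast
  have C: "open C" "connected C" "C \<subseteq> \<Omega>" "cis \<theta> \<in> C"
    using O(1) wC[OF \<open>1 \<in> J\<close>] q(1)
    by (auto simp: C_def open_connected_component dest: connected_component_in)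
  have Rw: "circle_reflection (w \<rho>) = w (1 / \<rho>)" for \<rho>
    by (simp add: w_def circle_reflection_polar)
  have diff: "(f has_derivative frechet_derivative f (at (w \<rho>))) (at (w \<rho>))" if "\<rho> \<in> J" for \<rho>
    using harm wC[OF that] C O by (intro C2_on_has_derivative(1)[where S = N]) (auto simp: harmonic_on_def)
  have radial: "dir_deriv (w \<rho>) f (w \<rho>) = of_real \<rho> * D \<rho>" if "\<rho> \<in> J" for \<rho>
    using linear_cmul[OF has_derivative_linear[OF diff[OF that]], of \<rho> "cis \<theta>"]
    by (simp add: dir_deriv_def D_def w_def scaleR_conv_of_real)
  have sum: "of_real \<rho> * D \<rho> + of_real (1 / \<rho>) * D (1 / \<rho>) =
      \<phi> (w \<rho>, 1 / w \<rho>) + \<phi> (w (1 / \<rho>), 1 / w (1 / \<rho>))" if "\<rho> \<in> J" for \<rho>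
    unfolding radial[OF that, symmetric] radial[OF J_inv[OF that], symmetric] Rw[symmetric]
  proof (rule neumann_reflection[OF harm holo C(1,2), where q = "cis \<theta>"])
    show "circle_reflection ` C \<subseteq> N" using C O by blast
    show "normal_deriv f w = \<phi> (w, cnj w)" if "w \<in> C" "norm w = 1" for w
      using neumann reflection_nbhd_sphere[OF \<Omega>(1)] C(3) that by auto
    show "circle_reflection (w \<rho>) \<in> C"
      using wC[OF J_inv[OF that]] by (simp add: Rw)
  qed (use C O q wC that in auto)
  have "f (w (1 / r)) = f (w r) - (LBINT \<rho>=ereal (1 / r)..ereal r. \<psi> \<rho>)"
  proof (rule integral_inversion_symmetric[OF r J_def, where E = "\<lambda>\<rho>. f (w \<rho>)"])
    fix \<rho> assume \<rho>: "\<rho> \<in> J"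
    have "(w has_vector_derivative cis \<theta>) (at \<rho>)"
      unfolding w_def[abs_def] by (auto intro!: derivative_eq_intros)
    from vector_derivative_diff_chain_within[OF has_vector_derivative_at_within[OF this]
        has_derivative_at_withinI[OF diff[OF \<rho>]]]
    show "((\<lambda>\<rho>. f (w \<rho>)) has_vector_derivative D \<rho>) (at \<rho> within J)"
      by (simp add: o_def D_def dir_deriv_def)
    \<comment> \<open>This is \<open>sum\<close> divided by \<open>\<rho>\<close>; the factor
      \<open>1 / \<rho>\<close> inside \<open>\<psi>\<close> accounts for the square in the
      denominator.\<close>
    show "D \<rho> + D (1 / \<rho>) / of_real (\<rho>\<^sup>2) = \<psi> \<rho> + \<psi> (1 / \<rho>) / of_real (\<rho>\<^sup>2)"
      using sum[OF \<rho>] J_pos[OF \<rho>] by (simp add: \<psi>_def field_simps power2_eq_square)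
  next
    have "(\<lambda>z. \<phi> (z, 1 / z)) field_differentiable at (w \<rho>)" if "\<rho> \<in> J" for \<rho>
      using wC[OF that] C O by (intro holomorphic2_on_hyperbola[OF holo]) auto
    then have "isCont (\<lambda>z. \<phi> (z, 1 / z)) (w \<rho>)" if "\<rho> \<in> J" for \<rho>
      using that field_differentiable_imp_continuous_at by blast
    then have "continuous_on (w ` J) (\<lambda>z. \<phi> (z, 1 / z))"
      by (auto intro: continuous_at_imp_continuous_on)
    moreover have "continuous_on J w"
      unfolding w_def[abs_def] by (intro continuous_intros)
    ultimately have "continuous_on J (\<lambda>\<rho>. \<phi> (w \<rho>, 1 / w \<rho>))"
      by (rule continuous_on_compose2) auto
    then show "continuous_on J \<psi>"
      unfolding \<psi>_def[abs_def] using J_pos by (intro continuous_intros) force+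
  qed
  then show ?thesis
    by (simp add: \<psi>_def w_def)
qed

section \<open>Existence of reflection-invariant neighborhoods\<close>

text \<open>In the coordinate \<open>log z\<close> the reflection is \<open>w \<mapsto> - cnj w\<close>, so the exponential images of
  small squares centred on the imaginary axis are suitable neighborhoods.\<close>

lemma reflection_nbhd_exists:
  assumes \<Gamma>: "\<Gamma> \<subseteq> sphere 0 1" and V: "open V" "p \<in> V" "V \<inter> sphere 0 1 \<subseteq> \<Gamma>" and p: "norm p = 1"
  shows "\<exists>\<Omega> \<Omega>\<^sub>1 \<Omega>\<^sub>2. reflection_nbhd \<Gamma> p \<Omega> \<Omega>\<^sub>1 \<Omega>\<^sub>2 \<and> \<Omega> \<subseteq> V \<and>
    (\<forall>z\<in>\<Omega>. closed_segment (circle_reflection z) z \<subseteq> \<Omega>)"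
proof -
  obtain \<alpha> where \<alpha>: "p = exp (\<i> * of_real \<alpha>)"
    using p by (metis cis_conv_exp rcis_cmod_Arg rcis_def mult_1 of_real_1)
  have "open (exp -` V :: complex set)"
    using V by (intro open_vimage continuous_intros) auto
  moreover have "\<i> * of_real \<alpha> \<in> exp -` V" using V \<alpha> by simp
  ultimately obtain d where d: "d > 0" "ball (\<i> * of_real \<alpha>) d \<subseteq> exp -` V"
    by (meson openE)
  \<comment> \<open>Half of \<open>d\<close> suffices because the modulus is at most the sum of the
    absolute values of the real and imaginary parts.\<close>
  define e where "e = d / 2"
  define P where "P = {w. \<bar>Re w\<bar> < e \<and> \<bar>Im w - \<alpha>\<bar> < e}"
  define P1 where "P1 = P \<inter> {w. Re w > 0}"
  define P2 where "P2 = P \<inter> {w. Re w < 0}"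
  have e: "e > 0" using d by (simp add: e_def)
  have P_box: "P = box (Complex (-e) (\<alpha> - e)) (Complex e (\<alpha> + e))"
    by (auto simp: P_def in_box_complex_iff abs_less_iff)
  have P: "open P" "convex P"
    unfolding P_box by (auto intro: open_box convex_box)
  have P1: "open P1" "convex P1" and P2: "open P2" "convex P2"
    using P unfolding P1_def P2_def
    by (auto intro!: open_Int convex_Int open_halfspace_Re_gt open_halfspace_Re_lt
        convex_halfspace_Re_gt convex_halfspace_Re_lt)
  have PV: "exp ` P \<subseteq> V"
  proof -
    have "w \<in> ball (\<i> * of_real \<alpha>) d" if "w \<in> P" for w
      using that cmod_le[of "w - \<i> * of_real \<alpha>"] by (auto simp: P_def e_def dist_norm norm_minus_commute)
    then show ?thesis using d by blast
  qed
  have open_exp: "open (exp ` Q)" if "open Q" for Q :: "complex set"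
  proof (rule open_mapping_thm[of exp UNIV Q])
    show "\<not> exp constant_on (UNIV :: complex set)"
    proof
      assume "exp constant_on (UNIV :: complex set)"
      then have "exp (0::complex) = exp (\<i> * of_real pi)"
        unfolding constant_on_def by (metis UNIV_I)
      then show False by simp
    qed
  qed (use that in \<open>auto intro: holomorphic_intros\<close>)
  have conn_exp: "connected (exp ` Q)" if "convex Q" for Q :: "complex set"
    using that by (intro connected_continuous_image continuous_intros convex_connected)
  have refl: "circle_reflection ` exp ` Q = exp ` (\<lambda>w. - cnj w) ` Q" for Q
    by (auto simp: image_image circle_reflection_exp)
  have swap: "(\<lambda>w. - cnj w) ` P = P" "(\<lambda>w. - cnj w) ` P1 = P2" "(\<lambda>w. - cnj w) ` P2 = P1"
    by (auto simp: P_def P1_def P2_def image_iff intro!: exI[of _ "- cnj _"] bexI[of _ "- cnj _"])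
  have "exp ` P - \<Gamma> = exp ` P1 \<union> exp ` P2"
  proof -
    \<comment> \<open>The modulus of \<open>exp w\<close> is \<open>exp (Re w)\<close>, and inside
      \<open>V\<close> the circle and \<open>\<Gamma>\<close> coincide.\<close>
    have "exp w \<in> \<Gamma> \<longleftrightarrow> Re w = 0" if "w \<in> P" for w
      using that PV V \<Gamma> by (auto simp: subset_iff)
    then show ?thesis by (force simp: P1_def P2_def)
  qed
  \<comment> \<open>Injectivity of \<open>exp\<close> on \<open>P\<close> is not guaranteed, so
    disjointness is read off from the modulus.\<close>
  have disj: "exp ` P1 \<inter> exp ` P2 = {}"
  proof -
    have "norm z > 1" if "z \<in> exp ` P1" for z using that by (auto simp: P1_def)
    moreover have "norm z < 1" if "z \<in> exp ` P2" for z using that by (auto simp: P2_def)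
    ultimately show ?thesis by force
  qed
  have ne: "P1 \<noteq> {}" "P2 \<noteq> {}"
  proof -
    have "Complex (e/2) \<alpha> \<in> P1" "Complex (-e/2) \<alpha> \<in> P2"
      using e by (auto simp: P1_def P2_def P_def)
    then show "P1 \<noteq> {}" "P2 \<noteq> {}" by auto
  qed
  have "components (exp ` P - \<Gamma>) = {exp ` P1, exp ` P2}"
    using disj ne P1 P2 \<open>exp ` P - \<Gamma> = exp ` P1 \<union> exp ` P2\<close>
    by (intro components_open_unique) (auto simp: pairwise_def disjnt_def open_exp conn_exp)
  moreover have "exp ` P1 \<noteq> exp ` P2" using disj ne by auto
  moreover have "p \<in> exp ` P" using e \<alpha> by (auto simp: P_def)
  moreover have "p \<in> \<Gamma>" using V p by auto
  ultimately have "reflection_nbhd \<Gamma> p (exp ` P) (exp ` P1) (exp ` P2)"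
    unfolding reflection_nbhd_def using open_exp[OF P(1)] refl swap by auto
  moreover have "closed_segment (circle_reflection z) z \<subseteq> exp ` P" if z: "z \<in> exp ` P" for z
  proof -
    obtain w where w: "w \<in> P" "z = exp w" using z by blast
    have polar: "z = of_real (exp (Re w)) * cis (Im w)" by (simp add: w exp_eq_polar)
    \<comment> \<open>In logarithmic coordinates the radial segment is horizontal and symmetric
      about the imaginary axis, so it stays in the square.\<close>
    have "of_real \<rho> * cis (Im w) \<in> exp ` P"
      if "\<rho> \<in> {min (1 / exp (Re w)) (exp (Re w))..max (1 / exp (Re w)) (exp (Re w))}" for \<rho>
    proof -
      have "exp (- \<bar>Re w\<bar>) \<le> \<rho>" "\<rho> \<le> exp \<bar>Re w\<bar>"
        using that unfolding inverse_eq_divide[symmetric] exp_minus[symmetric]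
        by (auto simp: min_def max_def abs_if split: if_splits)
      then have \<rho>: "0 < \<rho>" "\<bar>ln \<rho>\<bar> \<le> \<bar>Re w\<bar>"
        by (smt (verit) exp_gt_zero, smt (verit) exp_gt_zero exp_le_cancel_iff exp_ln)
      then have "of_real \<rho> * cis (Im w) = exp (Complex (ln \<rho>) (Im w))"
        by (simp add: exp_eq_polar)
      moreover have "Complex (ln \<rho>) (Im w) \<in> P"
        using \<rho> w by (auto simp: P_def)
      ultimately show ?thesis by blast
    qed
    then show ?thesis
      unfolding polar closed_segment_circle_reflection[OF exp_gt_zero] by blast
  qed
  ultimately show ?thesis using PV by blast
qed

text \<open>The first conjunct shows that the second is not vacuous. It speaks of relative interior
  points because circle points of \<open>\<Omega>\<close> must lie in \<open>\<Gamma>\<close>, which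
  rules out endpoints of the arc. The segment condition keeps the path of integration where
  \<open>\<phi>\<close> is defined.\<close>

theorem mainTheorem2:
  fixes \<Gamma> N :: "complex set"
    and U :: "(complex \<times> complex) set"
    and v \<phi> :: "complex \<times> complex \<Rightarrow> complex"
  assumes arc: "unit_circle_arc \<Gamma>"
    and near: "\<Gamma> \<subseteq> N"
    and harm: "harmonic_on (\<lambda>z. v (z, cnj z)) N"
    and near2: "\<forall>z\<in>\<Gamma>. (z, cnj z) \<in> U"
    and holo: "holomorphic2_on \<phi> U"
    and neumann: "\<forall>z\<in>\<Gamma>. normal_deriv (\<lambda>z. v (z, cnj z)) z = \<phi> (z, cnj z)"
  shows
    "(\<forall>p \<in> (top_of_set (sphere 0 1)) interior_of \<Gamma>.
        \<exists>\<Omega> \<Omega>\<^sub>1 \<Omega>\<^sub>2. reflection_nbhd \<Gamma> p \<Omega> \<Omega>\<^sub>1 \<Omega>\<^sub>2 \<and> problem_domain N U \<Omega> \<and>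
          (\<forall>z\<in>\<Omega>. closed_segment (circle_reflection z) z \<subseteq> \<Omega>)) \<and>
     (\<forall>p \<Omega> \<Omega>\<^sub>1 \<Omega>\<^sub>2. reflection_nbhd \<Gamma> p \<Omega> \<Omega>\<^sub>1 \<Omega>\<^sub>2 \<longrightarrow> problem_domain N U \<Omega> \<longrightarrow>
        (\<forall>(r::real) (\<theta>::real). 0 < r \<longrightarrow> of_real r * cis \<theta> \<in> \<Omega>\<^sub>1 \<longrightarrow>
          closed_segment (circle_reflection (of_real r * cis \<theta>)) (of_real r * cis \<theta>) \<subseteq> \<Omega> \<longrightarrow>
          v (cis \<theta> / of_real r, 1 / (of_real r * cis \<theta>)) =
            v (of_real r * cis \<theta>, of_real r * cis (- \<theta>)) -
            (LBINT \<rho>=1/r..r. \<phi> (of_real \<rho> * cis \<theta>, 1 / (of_real \<rho> * cis \<theta>)) / of_real \<rho>)))"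
proof (intro conjI ballI allI impI)
  fix p assume "p \<in> (top_of_set (sphere 0 1)) interior_of \<Gamma>"
  then obtain T where T: "open T" "p \<in> T" "sphere 0 1 \<inter> T \<subseteq> \<Gamma>" "p \<in> sphere 0 1"
    by (auto simp: interior_of_def openin_open)
  \<comment> \<open>\<open>W\<close> secures the data on the complexified circle, while
    \<open>T\<close> keeps the circle points of the neighborhood inside
    \<open>\<Gamma>\<close>.\<close>
  define W where "W = (\<lambda>w. (w, 1 / w)) -` U \<inter> (- {0})"
  have "open W"
    using holo unfolding W_def holomorphic2_on_def
    by (intro continuous_open_preimage[of "- {0}", unfolded Int_commute[of "- {0}"]] continuous_intros) auto
  moreover have p: "p \<in> \<Gamma>" "norm p = 1" using T by auto
  moreover from p have "p \<in> W"
    using near2 circle_reflection_fixes_sphere(2)[of p] by (auto simp: W_def)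
  moreover have "\<Gamma> \<subseteq> sphere 0 1" "open N"
    using arc harm by (auto simp: unit_circle_arc_def harmonic_on_def)
  ultimately obtain \<Omega> \<Omega>\<^sub>1 \<Omega>\<^sub>2 where "reflection_nbhd \<Gamma> p \<Omega> \<Omega>\<^sub>1 \<Omega>\<^sub>2" "\<Omega> \<subseteq> N \<inter> T \<inter> W"
    "\<forall>z\<in>\<Omega>. closed_segment (circle_reflection z) z \<subseteq> \<Omega>"
    using reflection_nbhd_exists[of \<Gamma> "N \<inter> T \<inter> W" p] T near by blast
  then show "\<exists>\<Omega> \<Omega>\<^sub>1 \<Omega>\<^sub>2. reflection_nbhd \<Gamma> p \<Omega> \<Omega>\<^sub>1 \<Omega>\<^sub>2 \<and> problem_domain N U \<Omega> \<and>
          (\<forall>z\<in>\<Omega>. closed_segment (circle_reflection z) z \<subseteq> \<Omega>)"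
    by (intro exI[of _ \<Omega>] exI[of _ \<Omega>\<^sub>1] exI[of _ \<Omega>\<^sub>2]) (auto simp: problem_domain_def W_def)
next
  fix p \<Omega> \<Omega>\<^sub>1 \<Omega>\<^sub>2 and r \<theta> :: real
  assume "reflection_nbhd \<Gamma> p \<Omega> \<Omega>\<^sub>1 \<Omega>\<^sub>2" "problem_domain N U \<Omega>" "0 < r"
    "closed_segment (circle_reflection (of_real r * cis \<theta>)) (of_real r * cis \<theta>) \<subseteq> \<Omega>"
  note formula = reflection_formula[OF harm holo neumann this]
  have "cnj (cis \<theta> / of_real r) = 1 / (of_real r * cis \<theta>)"
    "cnj (of_real r * cis \<theta>) = of_real r * cis (- \<theta>)"
    by (simp_all add: cis_cnj divide_inverse mult.commute flip: cis_inverse)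
  with formula show "v (cis \<theta> / of_real r, 1 / (of_real r * cis \<theta>)) =
            v (of_real r * cis \<theta>, of_real r * cis (- \<theta>)) -
            (LBINT \<rho>=1/r..r. \<phi> (of_real \<rho> * cis \<theta>, 1 / (of_real \<rho> * cis \<theta>)) / of_real \<rho>)"
    by (simp add: cis_cnj)
qed

end
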